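(* Let $G=(V,E)$ be a graph whose set of marked vertices is $M=\{i,j\}$, where $i$ and $j$ are adjacent and have the same degree $d_i=d_j=d$. Let $a$ be a scalar and put $$|\phi_{i,j}^a\rangle = -ad\left(|i,c_{(i,j)}\rangle + |j,c_{(j,i)}\rangle\right),\qquad |\phi_{stat}^a\rangle = a\sum_{v\in V}\sum_{c=0}^{d_v-1}|v,c\rangle + |\phi_{i,j}^a\rangle .$$ Then $|\phi_{stat}^a\rangle$ is not changed by a step of the search algorithm, that is, $U'|\phi_{stat}^a\rangle = |\phi_{stat}^a\rangle$.
   Context: $G=(V,E)$ is a finite simple undirected graph with $n=|V|$, $m=|E|$; $d_v$ is the degree of the vertex $v$. For each vertex $v$ its incident edges are labelled by directions $c\in\{0,\dots,d_v-1\}$; for adjacent $v,w$, $c_{(v,w)}$ denotes the direction at $v$ pointing to $w$. The walk acts on the $2m$-dimensional complex Hilbert space with orthonormal basis $\{|v,c\rangle : v\in V,\ 0\le c<d_v\}$. A set $M\subseteq V$ of marked vertices is given. The operators are: - Query: $Q = I-2\sum_{w\in M}\sum_{c=0}^{d_w-1}|w,c\rangle\langle w,c|$. - Coin: $C=\bigoplus_{v\in V} C_{d_v}$, where $C_{d_v}$ acts on the span of $|v,0\rangle,\dots,|v,d_v-1\rangle$ as the Grover diffusion $2|s_v\rangle\langle s_v|-I$ with $|s_v\rangle=\frac{1}{\sqrt{d_v}}\sum_{c=0}^{d_v-1}|v,c\rangle$. - Shift (flip-flop): $S|v,c_{(v,w)}\rangle=|w,c_{(w,v)}\rangle$ for every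 pair of adjacent vertices $v,w$. One step of the search algorithm is $U'=SCQ$. *)

theory Defs
  imports Complex_Main "HOL-Library.Function_Algebras" "Graph_Theory.Graph_Theory"
begin

text \<open>
  A finite simple undirected graph is a \<^locale>\<open>pair_graph\<close>: a finite, loop-free, symmetric set
  of ordered pairs, so that an edge is represented by its two orientations and the degree of a
  vertex is its out-degree. The number \<open>dir v w\<close> is the direction at \<open>v\<close> pointing to the
  neighbour \<open>w\<close>.
\<close>

abbreviation deg :: "'v pair_pre_digraph \<Rightarrow> 'v \<Rightarrow> nat" where
  "deg G v \<equiv> out_degree (with_proj G) v"

locale direction_labelled_graph = pair_graph G
  for G :: "'v pair_pre_digraph" and dir :: "'v \<Rightarrow> 'v \<Rightarrow> nat" +
  assumes dir_bij: "v \<in> pverts G \<Longrightarrow> bij_betw (dir v) {w. (v, w) \<in> parcs G} {..<deg G v}"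


text \<open>
  The Hilbert space is the subspace \<open>walk_space G\<close> of the complex functions on vertex-direction
  pairs; addition, subtraction and sums of states are those of functions. Operators are total
  functions, meaningful on \<open>walk_space G\<close>.
\<close>

type_synonym 'v state = "'v \<times> nat \<Rightarrow> complex"

definition walk_basis :: "'v pair_pre_digraph \<Rightarrow> ('v \<times> nat) set" where
  "walk_basis G = (SIGMA v:pverts G. {..<deg G v})"

definition walk_space :: "'v pair_pre_digraph \<Rightarrow> 'v state set" where
  "walk_space G = {\<psi>. \<forall>x. x \<notin> walk_basis G \<longrightarrow> \<psi> x = 0}"

definition cscale :: "complex \<Rightarrow> 'v state \<Rightarrow> 'v state" (infixr "*\<^sub>C" 75) where
  "a *\<^sub>C \<psi> = (\<lambda>x. a * \<psi> x)"

definition ket :: "'v \<times> nat \<Rightarrow> 'v state" where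
  "ket x = (\<lambda>y. if y = x then 1 else 0)"

definition walk_inner :: "'v pair_pre_digraph \<Rightarrow> 'v state \<Rightarrow> 'v state \<Rightarrow> complex" where
  "walk_inner G \<phi> \<psi> = (\<Sum>x\<in>walk_basis G. cnj (\<phi> x) * \<psi> x)"

text \<open>The operator $|\phi\rangle\langle\chi|$:\<close>

definition ketbra :: "'v pair_pre_digraph \<Rightarrow> 'v state \<Rightarrow> 'v state \<Rightarrow> 'v state \<Rightarrow> 'v state" where
  "ketbra G \<phi> \<chi> \<psi> = walk_inner G \<chi> \<psi> *\<^sub>C \<phi>"


definition query :: "'v pair_pre_digraph \<Rightarrow> 'v set \<Rightarrow> 'v state \<Rightarrow> 'v state" where
  "query G M \<psi> = \<psi> - 2 *\<^sub>C (\<Sum>w\<in>M. \<Sum>c<deg G w. ketbra G (ket (w, c)) (ket (w, c)) \<psi>)"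

definition diag_state :: "'v pair_pre_digraph \<Rightarrow> 'v \<Rightarrow> 'v state" where
  "diag_state G v = (1 / complex_of_real (sqrt (deg G v))) *\<^sub>C (\<Sum>c<deg G v. ket (v, c))"

text \<open>
  The Grover diffusion at \<open>v\<close>, extended by zero to the orthogonal complement of the span of the
  \<open>ket (v, c)\<close>; the identity on that span is the projection onto it, and the direct sum becomes
  an ordinary sum.
\<close>

definition grover :: "'v pair_pre_digraph \<Rightarrow> 'v \<Rightarrow> 'v state \<Rightarrow> 'v state" where
  "grover G v \<psi> = 2 *\<^sub>C ketbra G (diag_state G v) (diag_state G v) \<psi>
     - (\<Sum>c<deg G v. ketbra G (ket (v, c)) (ket (v, c)) \<psi>)"

definition coin :: "'v pair_pre_digraph \<Rightarrow> 'v state \<Rightarrow> 'v state" where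
  "coin G \<psi> = (\<Sum>v\<in>pverts G. grover G v \<psi>)"

text \<open>The linear map determined by \<open>shift_ket\<close> below:\<close>

definition shift :: "'v pair_pre_digraph \<Rightarrow> ('v \<Rightarrow> 'v \<Rightarrow> nat) \<Rightarrow> 'v state \<Rightarrow> 'v state" where
  "shift G dir \<psi> = (\<Sum>(v, w)\<in>parcs G. ketbra G (ket (w, dir w v)) (ket (v, dir v w)) \<psi>)"

definition search_step ::
    "'v pair_pre_digraph \<Rightarrow> ('v \<Rightarrow> 'v \<Rightarrow> nat) \<Rightarrow> 'v set \<Rightarrow> 'v state \<Rightarrow> 'v state" where
  "search_step G dir M = shift G dir \<circ> coin G \<circ> query G M"


definition pair_state :: "('v \<Rightarrow> 'v \<Rightarrow> nat) \<Rightarrow> nat \<Rightarrow> complex \<Rightarrow> 'v \<Rightarrow> 'v \<Rightarrow> 'v state" where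
  "pair_state dir d a i j = (- a * of_nat d) *\<^sub>C (ket (i, dir i j) + ket (j, dir j i))"

definition stat_state ::
    "'v pair_pre_digraph \<Rightarrow> ('v \<Rightarrow> 'v \<Rightarrow> nat) \<Rightarrow> nat \<Rightarrow> complex \<Rightarrow> 'v \<Rightarrow> 'v \<Rightarrow> 'v state" where
  "stat_state G dir d a i j =
     a *\<^sub>C (\<Sum>v\<in>pverts G. \<Sum>c<deg G v. ket (v, c)) + pair_state dir d a i j"


lemma sum_state_apply: "sum f A x = (\<Sum>k\<in>A. f k x)" for f :: "'k \<Rightarrow> 'v state"
  by (induction A rule: infinite_finite_induct) auto

lemma ket_apply: "ket x y = (if y = x then 1 else 0)"
  by (simp add: ket_def)

lemma ketbra_ket_apply:
  "ketbra G \<phi> (ket x) \<psi> y = (if finite (walk_basis G) \<and> x \<in> walk_basis G then \<psi> x * \<phi> y else 0)"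
proof -
  have *: "cnj (ket x z) * \<psi> z = (if z = x then \<psi> x else 0)" for z
    by (auto simp: ket_apply)
  show ?thesis
    by (cases "finite (walk_basis G)")
      (simp_all add: ketbra_def walk_inner_def cscale_def * del: complex_cnj_mult)
qed

lemma vector_space_cscale: "vector_space cscale"
  by unfold_locales (auto simp: cscale_def algebra_simps)

lemma walk_inner_add: "walk_inner G \<phi> (\<psi> + \<chi>) = walk_inner G \<phi> \<psi> + walk_inner G \<phi> \<chi>"
  by (simp add: walk_inner_def algebra_simps sum.distrib)

lemma walk_inner_cscale: "walk_inner G \<phi> (k *\<^sub>C \<psi>) = k * walk_inner G \<phi> \<psi>"
  by (simp add: walk_inner_def cscale_def sum_distrib_left mult_ac)

lemma linear_search_step: "Vector_Spaces.linear cscale cscale (search_step G dir M)"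
proof -
  interpret vector_space cscale by (rule vector_space_cscale)
  interpret vector_space_pair cscale cscale by unfold_locales
  have ketbra: "Vector_Spaces.linear cscale cscale (ketbra G \<phi> \<chi>)" for \<phi> \<chi>
    by unfold_locales
      (simp_all add: ketbra_def walk_inner_add walk_inner_cscale scale_left_distrib)
  have "Vector_Spaces.linear cscale cscale (query G M)"
    unfolding query_def[abs_def]
    by (intro linear_compose_sub linear_compose_scale_right linear_compose_sum ballI ketbra linear_ident)
  moreover have "Vector_Spaces.linear cscale cscale (coin G)"
    unfolding coin_def[abs_def] grover_def[abs_def]
    by (intro linear_compose_sub linear_compose_scale_right linear_compose_sum ballI ketbra)
  moreover have "Vector_Spaces.linear cscale cscale (shift G dir)"
    unfolding shift_def[abs_def] case_prod_beta
    by (intro linear_compose_sum ballI ketbra)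
  ultimately show ?thesis
    unfolding search_step_def using Vector_Spaces.linear_compose by blast
qed

context direction_labelled_graph
begin

lemma finite_walk_basis: "finite (walk_basis G)"
  unfolding walk_basis_def using pair_finite_verts by blast

lemma dir_less: "(v, w) \<in> parcs G \<Longrightarrow> dir v w < deg G v"
  using dir_bij[of v] in_arcsD1[of v w] by (auto simp: bij_betw_def)

lemma dir_in_walk_basis: "(v, w) \<in> parcs G \<Longrightarrow> (v, dir v w) \<in> walk_basis G"
  using in_arcsD1 dir_less by (auto simp: walk_basis_def)

lemma bij_betw_dir: "bij_betw (\<lambda>(v, w). (v, dir v w)) (parcs G) (walk_basis G)"
  unfolding bij_betw_def
proof
  show "inj_on (\<lambda>(v, w). (v, dir v w)) (parcs G)"
    using dir_bij in_arcsD1 by (fastforce simp: bij_betw_def inj_on_def)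
  show "(\<lambda>(v, w). (v, dir v w)) ` parcs G = walk_basis G"
  proof
    show "(\<lambda>(v, w). (v, dir v w)) ` parcs G \<subseteq> walk_basis G"
      using dir_in_walk_basis by auto
    show "walk_basis G \<subseteq> (\<lambda>(v, w). (v, dir v w)) ` parcs G"
    proof
      fix x assume "x \<in> walk_basis G"
      then obtain v c where x: "x = (v, c)" "v \<in> pverts G" "c < deg G v"
        by (auto simp: walk_basis_def)
      then have "c \<in> dir v ` {w. (v, w) \<in> parcs G}"
        using dir_bij[of v] by (simp add: bij_betw_def)
      with x show "x \<in> (\<lambda>(v, w). (v, dir v w)) ` parcs G" by force
    qed
  qed
qed

lemma card_walk_basis: "card (walk_basis G) = card (parcs G)"
  using bij_betw_same_card[OF bij_betw_dir] by simp

lemma ket_orthonormal: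
  "x \<in> walk_basis G \<Longrightarrow> walk_inner G (ket x) (ket y) = (if x = y then 1 else 0)"
proof -
  assume x: "x \<in> walk_basis G"
  have *: "cnj (ket x z) * ket y z = (if z = x then if x = y then 1 else 0 else 0)" for z
    by (auto simp: ket_apply)
  show ?thesis using x finite_walk_basis by (simp add: walk_inner_def *)
qed

lemma shift_ket:
  assumes "(v, w) \<in> parcs G"
  shows "shift G dir (ket (v, dir v w)) = ket (w, dir w v)"
proof
  fix y
  have *: "ketbra G (ket (q, dir q p)) (ket (p, dir p q)) (ket (v, dir v w)) y
      = (if (p, q) = (v, w) then ket (w, dir w v) y else 0)" if "(p, q) \<in> parcs G" for p q
    using that assms dir_in_walk_basis finite_walk_basis
      inj_onD[OF bij_betw_imp_inj_on[OF bij_betw_dir], of "(p, q)" "(v, w)"]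
    by (auto simp: ketbra_ket_apply ket_apply)
  have "shift G dir (ket (v, dir v w)) y
      = (\<Sum>e\<in>parcs G. if e = (v, w) then ket (w, dir w v) y else 0)"
    unfolding shift_def sum_state_apply
    by (rule sum.cong) (use * in \<open>auto split: if_splits\<close>)
  then show "shift G dir (ket (v, dir v w)) y = ket (w, dir w v) y"
    using assms pair_finite_arcs by simp
qed

lemma query_ket:
  assumes "(v, c) \<in> walk_basis G" "M \<subseteq> pverts G"
  shows "query G M (ket (v, c)) = (if v \<in> M then - ket (v, c) else ket (v, c))"
proof
  fix y
  have "finite M" using assms pair_finite_verts finite_subset by blast
  have *: "ketbra G (ket (w, b)) (ket (w, b)) (ket (v, c)) y
      = (if b = c then if w = v then ket (v, c) y else 0 else 0)" for w b
    using assms finite_walk_basis by (auto simp: ketbra_ket_apply ket_apply)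
  have "(\<Sum>w\<in>M. \<Sum>b<deg G w. ketbra G (ket (w, b)) (ket (w, b)) (ket (v, c)) y)
      = (\<Sum>w\<in>M. if w = v then ket (v, c) y else 0)"
    by (rule sum.cong) (use assms in \<open>auto simp: * walk_basis_def\<close>)
  also have "\<dots> = (if v \<in> M then ket (v, c) y else 0)" using \<open>finite M\<close> by simp
  finally show "query G M (ket (v, c)) y = (if v \<in> M then - ket (v, c) else ket (v, c)) y"
    by (simp add: query_def cscale_def sum_state_apply)
qed

lemma coin_ket:
  assumes "(v, c) \<in> walk_basis G"
  shows "coin G (ket (v, c)) = (2 / of_nat (deg G v)) *\<^sub>C (\<Sum>b<deg G v. ket (v, b)) - ket (v, c)"
proof
  fix y
  have vc: "v \<in> pverts G" "c < deg G v" using assms by (auto simp: walk_basis_def)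
  have d: "diag_state G u (v, c) = (if u = v then 1 / complex_of_real (sqrt (deg G v)) else 0)" for u
    using vc by (auto simp: diag_state_def cscale_def sum_state_apply ket_apply)
  have inner: "walk_inner G (diag_state G u) (ket (v, c))
      = (if u = v then 1 / complex_of_real (sqrt (deg G v)) else 0)" for u
  proof -
    have "walk_inner G (diag_state G u) (ket (v, c))
        = (\<Sum>x\<in>walk_basis G. if x = (v, c) then cnj (diag_state G u (v, c)) else 0)"
      unfolding walk_inner_def by (rule sum.cong) (auto simp: ket_apply)
    then show ?thesis using assms finite_walk_basis by (simp add: d)
  qed
  have proj: "(\<Sum>b<deg G u. ketbra G (ket (u, b)) (ket (u, b)) (ket (v, c)) y)
      = (if u = v then ket (v, c) y else 0)" for u
  proof -
    have "ketbra G (ket (u, b)) (ket (u, b)) (ket (v, c)) y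
        = (if b = c then if u = v then ket (v, c) y else 0 else 0)" for b
      using assms finite_walk_basis by (auto simp: ketbra_ket_apply ket_apply)
    then show ?thesis using vc by auto
  qed
  have sq: "complex_of_real (sqrt (deg G v)) * complex_of_real (sqrt (deg G v)) = of_nat (deg G v)"
    by (simp flip: of_real_mult)
  have diff: "ketbra G (diag_state G u) (diag_state G u) (ket (v, c)) y
      = (if u = v then (\<Sum>b<deg G v. ket (v, b) y) / of_nat (deg G v) else 0)" for u
    unfolding ketbra_def inner
    by (simp add: cscale_def diag_state_def sum_state_apply flip: sq)
  have "grover G u (ket (v, c)) y = (if u = v then
      ((2 / of_nat (deg G v)) *\<^sub>C (\<Sum>b<deg G v. ket (v, b)) - ket (v, c)) y else 0)" for u
    using diff[of u] proj[of u] by (simp add: grover_def cscale_def sum_state_apply)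
  then show "coin G (ket (v, c)) y
      = ((2 / of_nat (deg G v)) *\<^sub>C (\<Sum>b<deg G v. ket (v, b)) - ket (v, c)) y"
    using vc pair_finite_verts by (simp add: coin_def sum_state_apply)
qed

lemma search_step_in_walk_space: "search_step G dir M \<psi> \<in> walk_space G"
proof -
  have "shift G dir \<chi> x = 0" if "x \<notin> walk_basis G" for \<chi> x
    unfolding shift_def sum_state_apply
  proof (rule sum.neutral, clarify)
    fix v w assume vw: "(v, w) \<in> parcs G"
    then have "(w, v) \<in> parcs G"
      using pair_sym_arcs by (auto simp: symmetric_def dest: symD)
    then have "x \<noteq> (w, dir w v)" using dir_in_walk_basis that by blast
    then show "ketbra G (ket (w, dir w v)) (ket (v, dir v w)) \<chi> x = 0"
      by (simp add: ketbra_ket_apply ket_apply)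
  qed
  then show ?thesis by (simp add: walk_space_def search_step_def)
qed

lemma stat_state_in_walk_space:
  assumes "(i, j) \<in> parcs G"
  shows "stat_state G dir d a i j \<in> walk_space G"
proof -
  have "(j, i) \<in> parcs G"
    using assms pair_sym_arcs by (auto simp: symmetric_def dest: symD)
  then show ?thesis
    using assms dir_in_walk_basis[of i j] dir_in_walk_basis[of j i]
    by (auto simp: walk_space_def stat_state_def pair_state_def cscale_def sum_state_apply ket_apply
        walk_basis_def intro!: sum.neutral)
qed

end

end

theory Submission
  imports Defs
begin

text \<open>
  The query negates the amplitudes at \<open>i\<close> and \<open>j\<close>. Each of these two vertices carries the total
  amplitude \<open>d * a - a * d = 0\<close>, so the Grover diffusion merely negates its amplitudes back; at an
  unmarked vertex the state is uniform and hence fixed by the diffusion. Finally, the state is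
  symmetric under reversing an edge, so the shift fixes it.
\<close>

context direction_labelled_graph
begin

text \<open>Works on an arbitrary state, unlike \<open>query_ket\<close>, so that the operators can
  be followed amplitude by amplitude without expanding the state in kets.\<close>

lemma query_apply:
  assumes "(v, c) \<in> walk_basis G" and "finite M"
  shows "query G M \<psi> (v, c) = (if v \<in> M then - \<psi> (v, c) else \<psi> (v, c))"
proof -
  \<comment> \<open>The condition \<open>(w, b) = (v, c)\<close> is split into nested conditionals
    so that the sum over \<open>b\<close> and then the sum over \<open>w\<close> each collapse to
    one term.\<close>
  have *: "ketbra G (ket (w, b)) (ket (w, b)) \<psi> (v, c)
      = (if b = c then if w = v then \<psi> (v, c) else 0 else 0)" for w b
    using assms finite_walk_basis by (auto simp: ketbra_ket_apply ket_apply)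
  have "(\<Sum>w\<in>M. \<Sum>b<deg G w. ketbra G (ket (w, b)) (ket (w, b)) \<psi> (v, c))
      = (\<Sum>w\<in>M. if w = v then \<psi> (v, c) else 0)"
    by (rule sum.cong) (use assms in \<open>auto simp: * walk_basis_def\<close>)
  also have "\<dots> = (if v \<in> M then \<psi> (v, c) else 0)" using \<open>finite M\<close> by simp
  finally show ?thesis
    by (simp add: query_def cscale_def sum_state_apply)
qed

lemma diag_state_apply:
  "diag_state G u (v, c) = (if u = v \<and> c < deg G u then 1 / complex_of_real (sqrt (deg G u)) else 0)"
proof -
  have "ket (u, b) (v, c) = (if b = c then if u = v then 1 else 0 else 0)" for b
    by (auto simp: ket_apply)
  then show ?thesis by (simp add: diag_state_def cscale_def sum_state_apply)
qed

text \<open>\<open>diag_state G u\<close> is supported on the block of \<open>u\<close> and is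
  constant and real there, so the conjugation disappears and only that block survives.\<close>

lemma walk_inner_diag_state:
  assumes "u \<in> pverts G"
  shows "walk_inner G (diag_state G u) \<psi>
    = (\<Sum>b<deg G u. \<psi> (u, b)) / complex_of_real (sqrt (deg G u))"
proof -
  have "walk_inner G (diag_state G u) \<psi>
      = (\<Sum>v\<in>pverts G. \<Sum>b<deg G v. cnj (diag_state G u (v, b)) * \<psi> (v, b))"
    unfolding walk_inner_def walk_basis_def
    by (subst sum.Sigma) (use pair_finite_verts in auto)
  also have "\<dots> = (\<Sum>v\<in>pverts G. if v = u
      then (\<Sum>b<deg G u. \<psi> (u, b)) / complex_of_real (sqrt (deg G u)) else 0)"
    by (rule sum.cong) (auto simp: diag_state_apply sum_divide_distrib)
  finally show ?thesis using assms pair_finite_verts by simp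
qed

text \<open>Inversion about the average: of all the diffusions only the one at \<open>v\<close>
  reaches the entry \<open>(v, c)\<close>.\<close>

lemma coin_apply:
  assumes "(v, c) \<in> walk_basis G"
  shows "coin G \<psi> (v, c) = 2 / of_nat (deg G v) * (\<Sum>b<deg G v. \<psi> (v, b)) - \<psi> (v, c)"
proof -
  have vc: "v \<in> pverts G" "c < deg G v" using assms by (auto simp: walk_basis_def)
  \<comment> \<open>One root comes from the bra and one from the ket of \<open>diag_state\<close>;
    together they give the factor \<open>1 / deg G v\<close>.\<close>
  have sq: "complex_of_real (sqrt (deg G v)) * complex_of_real (sqrt (deg G v)) = of_nat (deg G v)"
    by (simp flip: of_real_mult)
  have proj: "(\<Sum>b<deg G u. ketbra G (ket (u, b)) (ket (u, b)) \<psi> (v, c))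
      = (if u = v then \<psi> (v, c) else 0)" for u
  proof -
    have "ketbra G (ket (u, b)) (ket (u, b)) \<psi> (v, c)
        = (if b = c then if u = v then \<psi> (v, c) else 0 else 0)" for b
      using assms finite_walk_basis by (auto simp: ketbra_ket_apply ket_apply)
    then show ?thesis using vc by auto
  qed
  have diff: "ketbra G (diag_state G u) (diag_state G u) \<psi> (v, c)
      = (if u = v then (\<Sum>b<deg G v. \<psi> (v, b)) / of_nat (deg G v) else 0)" for u
    using vc by (auto simp: ketbra_def cscale_def diag_state_apply walk_inner_diag_state simp flip: sq)
  have "grover G u \<psi> (v, c) = (if u = v then
      2 / of_nat (deg G v) * (\<Sum>b<deg G v. \<psi> (v, b)) - \<psi> (v, c) else 0)" for u
    using diff[of u] proj[of u] by (simp add: grover_def cscale_def sum_state_apply)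
  then show ?thesis
    using vc pair_finite_verts by (simp add: coin_def sum_state_apply)
qed

lemma parcs_sym: "(v, w) \<in> parcs G \<Longrightarrow> (w, v) \<in> parcs G"
  using pair_sym_arcs by (auto simp: symmetric_def dest: symD)

lemma parcs_neq: "(v, w) \<in> parcs G \<Longrightarrow> v \<noteq> w"
  using pair_no_loops by fastforce

text \<open>Injectivity of \<open>bij_betw_dir\<close>: comparing basis labels amounts to comparing
  arcs.\<close>

lemma dir_pair_eq_iff:
  assumes "(v, w) \<in> parcs G" "(p, q) \<in> parcs G"
  shows "(v, dir v w) = (p, dir p q) \<longleftrightarrow> v = p \<and> w = q"
  using inj_onD[OF bij_betw_imp_inj_on[OF bij_betw_dir], of "(v, w)" "(p, q)"] assms by auto

text \<open>Among the terms of the shift, only the one for the reversed arc \<open>(w, v)\<close>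
  has its ket at \<open>(v, dir v w)\<close>.\<close>

lemma shift_apply:
  assumes "(v, w) \<in> parcs G"
  shows "shift G dir \<psi> (v, dir v w) = \<psi> (w, dir w v)"
proof -
  have *: "ketbra G (ket (q, dir q p)) (ket (p, dir p q)) \<psi> (v, dir v w)
      = (if (p, q) = (w, v) then \<psi> (w, dir w v) else 0)" if "(p, q) \<in> parcs G" for p q
    using dir_pair_eq_iff[OF assms parcs_sym[OF that]] dir_in_walk_basis[OF that] finite_walk_basis
    by (auto simp: ketbra_ket_apply ket_apply)
  have "shift G dir \<psi> (v, dir v w) = (\<Sum>e\<in>parcs G. if e = (w, v) then \<psi> (w, dir w v) else 0)"
    unfolding shift_def sum_state_apply
    by (rule sum.cong) (use * in \<open>auto split: if_splits\<close>)
  then show ?thesis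
    using parcs_sym[OF assms] pair_finite_arcs by simp
qed

text \<open>Since \<open>i \<noteq> j\<close>, the two kets of \<open>pair_state\<close> are
  distinct and \<open>a * of_nat d\<close> is subtracted at most once.\<close>

lemma stat_state_apply:
  assumes "(v, c) \<in> walk_basis G" and "i \<noteq> j"
  shows "stat_state G dir d a i j (v, c)
    = a - (if (v, c) = (i, dir i j) \<or> (v, c) = (j, dir j i) then a * of_nat d else 0)"
proof -
  have vc: "v \<in> pverts G" "c < deg G v" using assms by (auto simp: walk_basis_def)
  have "(\<Sum>u\<in>pverts G. \<Sum>b<deg G u. ket (u, b) (v, c))
      = (\<Sum>u\<in>pverts G. if u = v then 1 else 0)"
    by (rule sum.cong) (use vc in \<open>auto simp: ket_apply\<close>)
  also have "\<dots> = (1 :: complex)" using vc pair_finite_verts by simp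
  finally show ?thesis
    using assms(2) by (auto simp: stat_state_def pair_state_def cscale_def sum_state_apply ket_apply)
qed

text \<open>Reversal swaps the two exceptional arcs \<open>(i, j)\<close> and \<open>(j, i)\<close>;
  on every other arc the amplitude is \<open>a\<close>.\<close>

lemma stat_state_flip:
  assumes "(v, w) \<in> parcs G" "(i, j) \<in> parcs G"
  shows "stat_state G dir d a i j (w, dir w v) = stat_state G dir d a i j (v, dir v w)"
proof -
  have "i \<noteq> j" using assms(2) parcs_neq by blast
  moreover note dir_pair_eq_iff[OF assms] dir_pair_eq_iff[OF assms(1) parcs_sym[OF assms(2)]]
    dir_pair_eq_iff[OF parcs_sym[OF assms(1)] assms(2)]
    dir_pair_eq_iff[OF parcs_sym[OF assms(1)] parcs_sym[OF assms(2)]]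
  ultimately show ?thesis
    using dir_in_walk_basis[OF assms(1)] dir_in_walk_basis[OF parcs_sym[OF assms(1)]]
    by (auto simp: stat_state_apply)
qed

lemma sum_stat_state_marked:
  assumes "(i, j) \<in> parcs G" "v = i \<or> v = j" "deg G v = d"
  shows "(\<Sum>b<d. stat_state G dir d a i j (v, b)) = 0"
proof -
  have ne: "i \<noteq> j" using assms(1) parcs_neq by blast
  have v: "v \<in> pverts G"
    using assms(1,2) in_arcsD1 in_arcsD2 by blast
  \<comment> \<open>The only direction at \<open>v\<close> along the edge joining \<open>i\<close>
    and \<open>j\<close>, hence the only one whose amplitude differs from the uniform
    formula.\<close>
  define b0 where "b0 = (if v = i then dir i j else dir j i)"
  have b0: "b0 < d"
    using dir_less[OF assms(1)] dir_less[OF parcs_sym[OF assms(1)]] assms(2,3) by (auto simp: b0_def)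
  have "(\<Sum>b<d. stat_state G dir d a i j (v, b)) = (\<Sum>b<d. a - (if b = b0 then a * of_nat d else 0))"
    by (rule sum.cong) (use ne v assms(2,3) in \<open>auto simp: stat_state_apply walk_basis_def b0_def\<close>)
  then show ?thesis using b0 by (simp add: sum_subtractf)
qed

lemma coin_query_stat_state:
  assumes "(i, j) \<in> parcs G" "deg G i = d" "deg G j = d" and vc: "(v, c) \<in> walk_basis G"
  shows "coin G (query G {i, j} (stat_state G dir d a i j)) (v, c) = stat_state G dir d a i j (v, c)"
proof -
  let ?s = "stat_state G dir d a i j"
  have ne: "i \<noteq> j" using assms(1) parcs_neq by blast
  have basis: "(v, b) \<in> walk_basis G" if "b < deg G v" for b
    using vc that by (auto simp: walk_basis_def)
  have pos: "deg G v > 0" using vc by (auto simp: walk_basis_def)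
  show ?thesis
  proof (cases "v \<in> {i, j}")
    case True
    then have d: "deg G v = d" using assms by auto
    have "(\<Sum>b<deg G v. query G {i, j} ?s (v, b)) = - (\<Sum>b<deg G v. ?s (v, b))"
      unfolding sum_negf[symmetric] by (rule sum.cong) (use basis True in \<open>auto simp: query_apply\<close>)
    also have "\<dots> = 0" using sum_stat_state_marked[OF assms(1) _ d] True d by simp
    finally show ?thesis using vc True by (simp add: coin_apply query_apply)
  next
    case False
    then have q: "query G {i, j} ?s (v, b) = a" if "b < deg G v" for b
      using basis[OF that] ne by (auto simp: query_apply stat_state_apply)
    \<comment> \<open>The sum is \<open>deg G v\<close> times \<open>a\<close>, and
      \<open>pos\<close> lets the degree cancel, leaving \<open>2 * a - a\<close>.\<close>
    have "coin G (query G {i, j} ?s) (v, c) = a"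
      using vc pos q by (simp add: coin_apply walk_basis_def)
    then show ?thesis using False vc ne by (auto simp: stat_state_apply)
  qed
qed

end

theorem theorem1:
  fixes G :: "'v pair_pre_digraph" and dir :: "'v \<Rightarrow> 'v \<Rightarrow> nat"
    and M :: "'v set" and i j :: 'v and d :: nat and a :: complex
  assumes "direction_labelled_graph G dir"
    and "M = {i, j}"
    and "(i, j) \<in> parcs G"
    and "deg G i = d"
    and "deg G j = d"
  shows "search_step G dir M (stat_state G dir d a i j) = stat_state G dir d a i j"
proof
  interpret direction_labelled_graph G dir by fact
  let ?s = "stat_state G dir d a i j"
  fix x
  show "search_step G dir M ?s x = ?s x"
  proof (cases "x \<in> walk_basis G")
    case True
    \<comment> \<open>Every basis label comes from an arc, the form that \<open>shift_apply\<close>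
      requires.\<close>
    then obtain v w where vw: "(v, w) \<in> parcs G" and x: "x = (v, dir v w)"
      unfolding bij_betw_imp_surj_on[OF bij_betw_dir, symmetric] by auto
    have "search_step G dir M ?s x = coin G (query G {i, j} ?s) (w, dir w v)"
      using shift_apply[OF vw] by (simp add: search_step_def x assms(2))
    also have "\<dots> = ?s (w, dir w v)"
      using coin_query_stat_state assms(3-5) dir_in_walk_basis[OF parcs_sym[OF vw]] by blast
    also have "\<dots> = ?s x"
      using stat_state_flip[OF vw assms(3)] x by simp
    finally show ?thesis .
  next
    case False
    then show ?thesis
      \<comment> \<open>States are total functions, so labels outside the basis must be checked too;
        both sides vanish there.\<close>
      using search_step_in_walk_space[of M ?s] stat_state_in_walk_space[OF assms(3)]
      by (cases x) (simp add: walk_space_def)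
  qed
qed

end
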